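(* Let $\Sigma\subset\mathbb{R}^d$ be a $C^2$-smooth strictly convex hypersurface with strictly positive curvature at every point. There exists a constant $C(\Sigma)>0$ such that for any piece of billiard trajectory $\{x_{-1},x_0,x_1\}$ in $\Sigma$ whose angle of reflection $\varphi$ at the point $x_0$ is smaller than $C(\Sigma)$ the following holds: $$\delta^2\Phi_{00}(\xi)>0\quad\text{for all nonzero } \xi\in T_{x_0}\Sigma \text{ with } \xi\perp v_0,$$ and $$\delta^2\Phi_{00}(\xi)<0\quad\text{for all nonzero } \xi\in T_{x_0}\Sigma \text{ with } \xi\parallel v_0.$$
   Context: $\Sigma$ is the (compact) boundary of the convex billiard table in $\mathbb{R}^d$; positive curvature means that the second fundamental form with respect to the inward unit normal is positive definite at every point. A piece of billiard trajectory $\{x_{-1},x_0,x_1\}$ consists of points of $\Sigma$ with $x_{-1}\neq x_0\ne x_1$ obeying the billiard reflection law at $x_0$; equivalently, $x_0$ is a critical point of the function $\Phi_{00}(u)=|x_{-1}-u|+|u-x_1|$ of $u\in\Sigma$. The quadratic form $\delta^2\Phi_{00}$ on $T_{x_0}\Sigma$ is the second variation (Hessian quadratic form) of $\Phi_{00}$ at the critical point $x_0$, with respect to the induced Riemannian metric on $\Sigma$. The vector $v_0\in T_{x_0}\Sigma$ is the orthogonal projection of the unit vector $(x_1-x_0)/|x_1-x_0|$ onto $T_{x_0}\Sigma$. The angle of reflection $\varphi\in(0,\pi/2]$ at $x_0$ is the angle between $x_1-x_0$ and $T_{x_0}\Sigma$, so $\sin\varphi=\sqrt{1-|v_0|^2}$.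 *)

theory Defs
  imports "HOL-Analysis.Analysis"
begin

text \<open>An embedded hypersurface of class C2, given locally as a regular level set: near each of its
  points it is the zero set of a function \<open>f\<close> whose gradient \<open>g\<close> does not vanish and whose Hessian
  \<open>H\<close>, the derivative of \<open>g\<close>, is continuous.\<close>

definition C2_hypersurface :: "'a::euclidean_space set \<Rightarrow> bool" where
  "C2_hypersurface S \<longleftrightarrow>
     (\<forall>p\<in>S. \<exists>(U :: 'a set) (f :: 'a \<Rightarrow> real) (g :: 'a \<Rightarrow> 'a) (H :: 'a \<Rightarrow> 'a \<Rightarrow>\<^sub>L 'a).
        open U \<and> p \<in> U \<and>
        (\<forall>x\<in>U. GDERIV f x :> g x \<and> g x \<noteq> 0 \<and> (g has_derivative blinfun_apply (H x)) (at x)) \<and>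
        continuous_on U H \<and>
        S \<inter> U = {x\<in>U. f x = 0})"

text \<open>For a convex body this says that its boundary contains no nondegenerate segment.\<close>

definition strictly_convex :: "'a::euclidean_space set \<Rightarrow> bool" where
  "strictly_convex K \<longleftrightarrow> (\<forall>x\<in>K. \<forall>y\<in>K. x \<noteq> y \<longrightarrow> open_segment x y \<subseteq> interior K)"

text \<open>\<open>curve_on S \<gamma> x \<xi> a\<close>: near time 0, \<open>\<gamma>\<close> is a C2 curve in \<open>S\<close> passing at time 0 through \<open>x\<close>
  with velocity \<open>\<xi>\<close> and acceleration \<open>a\<close> (derivatives being taken in the ambient space).\<close>

definition curve_on ::
    "'a::euclidean_space set \<Rightarrow> (real \<Rightarrow> 'a) \<Rightarrow> 'a \<Rightarrow> 'a \<Rightarrow> 'a \<Rightarrow> bool" where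
  "curve_on S \<gamma> x \<xi> a \<longleftrightarrow>
     (\<exists>(\<gamma>' :: real \<Rightarrow> 'a) (\<gamma>'' :: real \<Rightarrow> 'a) \<epsilon>. 0 < \<epsilon> \<and>
        (\<forall>t\<in>{-\<epsilon><..<\<epsilon>}. \<gamma> t \<in> S \<and>
           (\<gamma> has_vector_derivative \<gamma>' t) (at t) \<and>
           (\<gamma>' has_vector_derivative \<gamma>'' t) (at t)) \<and>
        continuous_on {-\<epsilon><..<\<epsilon>} \<gamma>'' \<and>
        \<gamma> 0 = x \<and> \<gamma>' 0 = \<xi> \<and> \<gamma>'' 0 = a)"

definition tangent_space :: "'a::euclidean_space set \<Rightarrow> 'a \<Rightarrow> 'a set" where
  "tangent_space S x = {\<xi>. \<exists>\<gamma> a. curve_on S \<gamma> x \<xi> a}"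

definition tangent_projection :: "'a::euclidean_space set \<Rightarrow> 'a \<Rightarrow> 'a \<Rightarrow> 'a" where
  "tangent_projection S x u =
     (THE v. v \<in> tangent_space S x \<and> (\<forall>w\<in>tangent_space S x. orthogonal (u - v) w))"

text \<open>The inward unit normal of the boundary of a convex body \<open>K\<close>: as \<open>K\<close> lies on one side of each
  tangent hyperplane, the normal points inward precisely when it points to that side.\<close>

definition inward_normal :: "'a::euclidean_space set \<Rightarrow> 'a \<Rightarrow> 'a" where
  "inward_normal K x =
     (THE \<nu>. norm \<nu> = 1 \<and> (\<forall>w\<in>tangent_space (frontier K) x. orthogonal \<nu> w) \<and>
            (\<forall>y\<in>K. 0 \<le> (y - x) \<bullet> \<nu>))"

text \<open>The second fundamental form of the boundary with respect to the inward unit normal, as a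
  quadratic form: the normal component of the acceleration of a curve on the boundary depends on
  the velocity \<open>\<xi>\<close> only. It is meaningful for tangent vectors \<open>\<xi>\<close>.\<close>

definition second_fundamental_form :: "'a::euclidean_space set \<Rightarrow> 'a \<Rightarrow> 'a \<Rightarrow> real" where
  "second_fundamental_form K x \<xi> =
     (THE q. \<exists>\<gamma> a. curve_on (frontier K) \<gamma> x \<xi> a \<and> q = a \<bullet> inward_normal K x)"

definition positive_curvature :: "'a::euclidean_space set \<Rightarrow> bool" where
  "positive_curvature K \<longleftrightarrow>
     (\<forall>x\<in>frontier K. \<forall>\<xi>\<in>tangent_space (frontier K) x. \<xi> \<noteq> 0 \<longrightarrow>
        0 < second_fundamental_form K x \<xi>)"

text \<open>The Hessian quadratic form of \<open>F\<close> restricted to \<open>S\<close>, with respect to the induced metric: the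
  second derivative of \<open>F\<close> along a curve on \<open>S\<close> with velocity \<open>\<xi>\<close> that is geodesic to second order,
  that is, whose covariant acceleration (the tangential part of \<open>a\<close>) vanishes at time 0. At a
  critical point of \<open>F\<close> on \<open>S\<close> every curve with velocity \<open>\<xi>\<close> gives the same value.\<close>

definition second_variation ::
    "'a::euclidean_space set \<Rightarrow> ('a \<Rightarrow> real) \<Rightarrow> 'a \<Rightarrow> 'a \<Rightarrow> real" where
  "second_variation S F x \<xi> =
     (THE q. \<exists>\<gamma> a. curve_on S \<gamma> x \<xi> a \<and> (\<forall>w\<in>tangent_space S x. orthogonal a w) \<and>
                  q = deriv (deriv (\<lambda>t. F (\<gamma> t))) 0)"

definition unit_direction :: "'a::euclidean_space \<Rightarrow> 'a \<Rightarrow> 'a" where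
  "unit_direction x y = (y - x) /\<^sub>R norm (y - x)"

text \<open>In names ending in \<open>m\<close>, as in \<open>xm\<close>, the letter stands for the index -1.\<close>

definition billiard_piece :: "'a::euclidean_space set \<Rightarrow> 'a \<Rightarrow> 'a \<Rightarrow> 'a \<Rightarrow> bool" where
  "billiard_piece K xm x0 x1 \<longleftrightarrow>
     xm \<in> frontier K \<and> x0 \<in> frontier K \<and> x1 \<in> frontier K \<and> xm \<noteq> x0 \<and> x0 \<noteq> x1 \<and>
     unit_direction x0 x1 =
       unit_direction xm x0 -
         (2 * (unit_direction xm x0 \<bullet> inward_normal K x0)) *\<^sub>R inward_normal K x0"

definition \<Phi>00 :: "'a::euclidean_space \<Rightarrow> 'a \<Rightarrow> 'a \<Rightarrow> real" where
  "\<Phi>00 xm x1 u = norm (xm - u) + norm (u - x1)"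

definition v0 :: "'a::euclidean_space set \<Rightarrow> 'a \<Rightarrow> 'a \<Rightarrow> 'a" where
  "v0 S x0 x1 = tangent_projection S x0 (unit_direction x0 x1)"

definition reflection_angle :: "'a::euclidean_space set \<Rightarrow> 'a \<Rightarrow> 'a \<Rightarrow> real" where
  "reflection_angle S x0 x1 = arcsin (sqrt (1 - (norm (v0 S x0 x1))\<^sup>2))"

end

theory Submission
  imports Defs
begin

text \<open>
  Let \<open>{x\<^sub>-, x\<^sub>0, x\<^sub>+}\<close> be a piece of trajectory whose legs at \<open>x\<^sub>0\<close> have lengths \<open>l\<^sub>-\<close> and \<open>l\<^sub>+\<close>, let \<open>\<phi>\<close>
  be the reflection angle and \<open>II\<close> the second fundamental form at \<open>x\<^sub>0\<close>. Differentiating the length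
  twice along a curve with normal acceleration gives
  \<open>\<delta>\<^sup>2\<Phi>(\<xi>) = (|\<xi>|\<^sup>2 - (\<xi> \<bullet> v\<^sub>0)\<^sup>2) (1 / l\<^sub>- + 1 / l\<^sub>+) - 2 sin \<phi> II(\<xi>)\<close>.
  This is a sum of one contribution for each leg, and each contribution has the asserted sign
  (\<open>second_variation_length\<close>, \<open>leg_variation_signs_near\<close>).

  For \<open>\<xi>\<close> orthogonal to \<open>v\<^sub>0\<close> the contribution of a leg of length \<open>l\<close> is \<open>|\<xi>|\<^sup>2 / l - sin \<phi> II(\<xi>)\<close>. The
  first term is at least \<open>|\<xi>|\<^sup>2\<close> divided by the diameter of the table, and \<open>II\<close> is bounded on unit
  vectors, so a small \<open>\<phi>\<close> makes it positive.

  For \<open>\<xi>\<close> parallel to \<open>v\<^sub>0\<close> we have \<open>|\<xi>|\<^sup>2 - (\<xi> \<bullet> v\<^sub>0)\<^sup>2 = |\<xi>|\<^sup>2 (sin \<phi>)\<^sup>2\<close>, and the contribution is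
  \<open>sin \<phi> (|\<xi>|\<^sup>2 sin \<phi> / l - II(\<xi>))\<close>. By Taylor expansion of the local equation along the chord
  (\<open>chord_taylor\<close>), \<open>sin \<phi> / l\<close> is close to half the normal curvature in the direction of \<open>v\<^sub>0\<close> when the
  leg is short; when it is not, \<open>sin \<phi> / l\<close> is itself small. As the curvature is bounded below by a
  positive constant (\<open>uniformly_negative_definite\<close>), \<open>sin \<phi> / l\<close> is less than the curvature in both
  cases, and the contribution is negative.

  All estimates are uniform near a given boundary point, and compactness of the boundary gives one
  constant for the whole table. Curves realising a given tangent vector, which the definitions of
  tangent space, curvature and second variation require, come from the inverse function theorem
  (\<open>curve_in_level_chart_exists\<close>).
\<close>

section \<open>Local equations of a hypersurface\<close>

text \<open>Every geometric notion of the statement is given by curves on the hypersurface and a definite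
  description. All of them are evaluated below in terms of one local equation \<open>f = 0\<close> with gradient
  \<open>g\<close> and Hessian \<open>H\<close>, which this predicate fixes.\<close>

definition level_chart ::
    "'a::euclidean_space set \<Rightarrow> 'a set \<Rightarrow> ('a \<Rightarrow> real) \<Rightarrow> ('a \<Rightarrow> 'a) \<Rightarrow> ('a \<Rightarrow> 'a \<Rightarrow>\<^sub>L 'a) \<Rightarrow> bool" where
  "level_chart S U f g H \<longleftrightarrow>
     open U \<and>
     (\<forall>x\<in>U. GDERIV f x :> g x \<and> g x \<noteq> 0 \<and> (g has_derivative blinfun_apply (H x)) (at x)) \<and>
     continuous_on U H \<and>
     S \<inter> U = {x\<in>U. f x = 0}"

lemma level_chartD:
  assumes "level_chart S U f g H"
  shows "open U" "continuous_on U H" "S \<inter> U = {x\<in>U. f x = 0}"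
    and "\<And>x. x \<in> U \<Longrightarrow> (f has_derivative (\<lambda>h. h \<bullet> g x)) (at x)"
    and "\<And>x. x \<in> U \<Longrightarrow> g x \<noteq> 0"
    and "\<And>x. x \<in> U \<Longrightarrow> (g has_derivative blinfun_apply (H x)) (at x)"
    and "continuous_on U g"
  using assms
  by (auto simp: level_chart_def gderiv_def
      intro: continuous_at_imp_continuous_on has_derivative_continuous)

lemma C2_hypersurface_chart:
  assumes "C2_hypersurface S" "p \<in> S"
  obtains U f g H where "level_chart S U f g H" "p \<in> U"
  using assms unfolding C2_hypersurface_def level_chart_def by meson

lemma level_chart_uminus:
  assumes "level_chart S U f g H"
  shows "level_chart S U (\<lambda>x. - f x) (\<lambda>x. - g x) (\<lambda>x. - H x)"
  using assms unfolding level_chart_def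
  by (auto intro!: GDERIV_minus has_derivative_minus continuous_on_minus
      simp: blinfun.minus_left[abs_def])

lemma has_vector_derivative_inner:
  fixes u v :: "real \<Rightarrow> 'a::euclidean_space"
  assumes "(u has_vector_derivative u') (at t)" "(v has_vector_derivative v') (at t)"
  shows "((\<lambda>t. u t \<bullet> v t) has_real_derivative (u t \<bullet> v' + u' \<bullet> v t)) (at t)"
  using has_derivative_inner[OF assms[unfolded has_vector_derivative_def]]
  unfolding has_field_derivative_def
  by (rule has_derivative_eq_rhs) (auto simp: algebra_simps)

lemma has_vector_derivative_compose:
  fixes u :: "real \<Rightarrow> 'a::real_normed_vector"
  assumes "(u has_vector_derivative u') (at t)" "(F has_derivative F') (at (u t))"
  shows "((\<lambda>t. F (u t)) has_vector_derivative F' u') (at t)"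
  using vector_derivative_diff_chain_within[OF assms(1), of F F'] assms(2)
  by (auto simp: o_def intro: has_derivative_at_withinI)

text \<open>Differentiating \<open>f (\<gamma> t) = 0\<close> once shows that velocities are orthogonal to the gradient, and twice
  that the normal component of the acceleration depends on the velocity alone. The latter is what
  makes the second fundamental form well defined.\<close>

lemma curve_in_level_chart:
  assumes chart: "level_chart S U f g H" and "x \<in> U" and "curve_on S \<gamma> x \<xi> a"
  shows "\<xi> \<bullet> g x = 0" and "a \<bullet> g x = - (\<xi> \<bullet> H x \<xi>)"
proof -
  note D = level_chartD[OF chart]
  from assms(3) obtain \<gamma>' \<gamma>'' \<epsilon> where "0 < \<epsilon>"
    and c: "\<And>t. t \<in> {-\<epsilon><..<\<epsilon>} \<Longrightarrow> \<gamma> t \<in> S"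
      "\<And>t. t \<in> {-\<epsilon><..<\<epsilon>} \<Longrightarrow> (\<gamma> has_vector_derivative \<gamma>' t) (at t)"
      "\<And>t. t \<in> {-\<epsilon><..<\<epsilon>} \<Longrightarrow> (\<gamma>' has_vector_derivative \<gamma>'' t) (at t)"
    and i: "\<gamma> 0 = x" "\<gamma>' 0 = \<xi>" "\<gamma>'' 0 = a"
    unfolding curve_on_def by metis
  define I where "I = {t \<in> {-\<epsilon><..<\<epsilon>}. \<gamma> t \<in> U}"
  have "continuous_on {-\<epsilon><..<\<epsilon>} \<gamma>"
    by (intro continuous_at_imp_continuous_on ballI has_vector_derivative_continuous[OF c(2)])
  then have "open I"
    unfolding I_def using D(1) continuous_open_preimage[of "{-\<epsilon><..<\<epsilon>}" \<gamma> U]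
    by (auto simp: Int_def vimage_def)
  have "0 \<in> I" using \<open>0 < \<epsilon>\<close> i \<open>x \<in> U\<close> by (auto simp: I_def)
  have const: "d = 0" if "(h has_real_derivative d) (at t)" "t \<in> I" "\<And>t. t \<in> I \<Longrightarrow> h t = 0"
    for h d t
  proof -
    obtain e where "e > 0" "ball t e \<subseteq> I" using \<open>open I\<close> \<open>t \<in> I\<close> openE by blast
    then show ?thesis
      using DERIV_local_const[OF that(1) \<open>e > 0\<close>] that(2,3) by (force simp: dist_real_def)
  qed
  have v: "\<gamma>' t \<bullet> g (\<gamma> t) = 0" if "t \<in> I" for t
  proof (rule const[OF _ that])
    show "((\<lambda>t. f (\<gamma> t)) has_real_derivative \<gamma>' t \<bullet> g (\<gamma> t)) (at t)"
      using has_vector_derivative_compose[OF c(2) D(4)] that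
      by (auto simp: I_def has_real_derivative_iff_has_vector_derivative)
    show "f (\<gamma> t) = 0" if "t \<in> I" for t
      using that c(1) D(3) by (auto simp: I_def)
  qed
  show "\<xi> \<bullet> g x = 0" using v[OF \<open>0 \<in> I\<close>] i by simp
  have "\<gamma>' 0 \<bullet> H (\<gamma> 0) (\<gamma>' 0) + \<gamma>'' 0 \<bullet> g (\<gamma> 0) = 0"
  proof (rule const[OF has_vector_derivative_inner \<open>0 \<in> I\<close> v])
    show "(\<gamma>' has_vector_derivative \<gamma>'' 0) (at 0)" using c(3) \<open>0 < \<epsilon>\<close> by auto
    show "((\<lambda>t. g (\<gamma> t)) has_vector_derivative H (\<gamma> 0) (\<gamma>' 0)) (at 0)"
      using has_vector_derivative_compose[OF c(2) D(6)] \<open>0 < \<epsilon>\<close> i \<open>x \<in> U\<close> by auto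
  qed
  then show "a \<bullet> g x = - (\<xi> \<bullet> H x \<xi>)" using i by simp
qed

text \<open>Conversely every direction orthogonal to the gradient is a velocity, even of a curve whose
  acceleration is normal. Such a curve comes from the inverse function theorem: the map \<open>\<Psi>\<close> replaces
  the normal coordinate of a point by the value of \<open>f\<close> there, so its local inverse carries the line
  spanned by \<open>\<xi>\<close>, on which the normal coordinate is 0, into the zero set of \<open>f\<close>. As \<open>\<Psi>\<close> preserves
  the tangential coordinates, the curve moves off the line only along the normal.\<close>

lemma curve_in_level_chart_exists:
  assumes chart: "level_chart S U f g H" and "x \<in> S" "x \<in> U" and "\<xi> \<bullet> g x = 0"
  shows "\<exists>\<gamma> c. curve_on S \<gamma> x \<xi> (c *\<^sub>R g x)"
proof -
  note D = level_chartD[OF chart]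
  \<comment> \<open>The scaling makes the derivative of \<open>\<Psi>\<close> at \<open>x\<close> the identity.\<close>
  define w where "w = g x /\<^sub>R (norm (g x))\<^sup>2"
  have gw: "g x \<bullet> w = 1"
    using D(5)[OF \<open>x \<in> U\<close>] by (simp add: w_def power2_norm_eq_inner)
  have gs: "g x \<bullet> \<xi> = 0" using assms by (simp add: inner_commute)
  have "w \<noteq> 0" using gw by auto
  define \<Psi> where "\<Psi> u = (u - x) + (f u - g x \<bullet> (u - x)) *\<^sub>R w" for u
  define \<Psi>' where
    "\<Psi>' u = id_blinfun + (blinfun_scaleR_left w o\<^sub>L blinfun_inner_left (g u - g x))" for u
  have \<Psi>': "\<Psi>' u h = h + (h \<bullet> g u - h \<bullet> g x) *\<^sub>R w" for u h
    by (simp add: \<Psi>'_def blinfun.add_left inner_diff_right)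
  have der: "(\<Psi> has_derivative \<Psi>' u) (at u)" if "u \<in> U" for u
    unfolding \<Psi>_def
    by (rule derivative_eq_intros D(4)[OF that] refl)+
      (auto simp: fun_eq_iff \<Psi>' inner_commute algebra_simps)
  have cont: "continuous_on U \<Psi>'"
    unfolding \<Psi>'_def using D(7) by (intro continuous_intros) auto
  have "id_blinfun o\<^sub>L \<Psi>' x = id_blinfun"
    by (rule blinfun_eqI) (simp add: \<Psi>')
  from inverse_function_theorem[OF D(1) der cont \<open>x \<in> U\<close> this] obtain U' V k k' where
    U': "open U'" "U' \<subseteq> U" "x \<in> U'" and V: "open V" "\<Psi> x \<in> V"
    and hom: "homeomorphism U' V \<Psi> k"
    and k: "\<And>y. y \<in> V \<Longrightarrow> (k has_derivative k' y) (at y)"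
    and k': "\<And>y. y \<in> V \<Longrightarrow> k' y = inv (blinfun_apply (\<Psi>' (k y)))"
    and bij: "\<And>y. y \<in> V \<Longrightarrow> bij (blinfun_apply (\<Psi>' (k y)))"
    by metis
  have \<Psi>x: "\<Psi> x = 0"
    using D(3) \<open>x \<in> S\<close> \<open>x \<in> U\<close> by (auto simp: \<Psi>_def)
  have kU: "k y \<in> U" and \<Psi>k: "\<Psi> (k y) = y" if "y \<in> V" for y
    using hom that U'(2) by (auto simp: homeomorphism_def)
  have k0: "k 0 = x" using hom U'(3) \<Psi>x by (metis homeomorphism_apply1)
  have fk: "f (k y) = g x \<bullet> y" if "y \<in> V" for y
  proof -
    have "g x \<bullet> \<Psi> (k y) = f (k y)" by (simp add: \<Psi>_def inner_add_right gw)
    then show ?thesis using \<Psi>k[OF that] by simp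
  qed
  have gkw: "w \<bullet> g (k y) \<noteq> 0" if "y \<in> V" for y
  proof
    assume "w \<bullet> g (k y) = 0"
    then have "\<Psi>' (k y) w = \<Psi>' (k y) 0" using gw by (simp add: \<Psi>' inner_commute)
    then show False using bij[OF that] \<open>w \<noteq> 0\<close> by (meson bij_is_inj injD)
  qed
  define \<gamma> where "\<gamma> t = k (t *\<^sub>R \<xi>)" for t
  \<comment> \<open>The velocity, obtained by solving \<open>\<Psi>' (\<gamma> t) (\<gamma>' t) = \<xi>\<close>; the scalar \<open>c t\<close> is the derivative
    of its \<open>w\<close>-component.\<close>
  define \<gamma>' where "\<gamma>' t = \<xi> - ((\<xi> \<bullet> g (\<gamma> t)) / (w \<bullet> g (\<gamma> t))) *\<^sub>R w" for t
  define c where "c t = - (((\<xi> \<bullet> H (\<gamma> t) (\<gamma>' t)) * (w \<bullet> g (\<gamma> t)) -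
      (\<xi> \<bullet> g (\<gamma> t)) * (w \<bullet> H (\<gamma> t) (\<gamma>' t))) / ((w \<bullet> g (\<gamma> t)) * (w \<bullet> g (\<gamma> t))))" for t
  have "open ((\<lambda>t. t *\<^sub>R \<xi>) -` V)"
    by (intro open_vimage V continuous_intros)
  moreover have "0 \<in> (\<lambda>t. t *\<^sub>R \<xi>) -` V" using V \<Psi>x by simp
  ultimately obtain \<epsilon> where "0 < \<epsilon>" and \<epsilon>: "ball 0 \<epsilon> \<subseteq> (\<lambda>t. t *\<^sub>R \<xi>) -` V"
    by (meson open_contains_ball)
  have inV: "t *\<^sub>R \<xi> \<in> V" if "t \<in> {-\<epsilon><..<\<epsilon>}" for t
    using that \<epsilon> by (auto simp: subset_iff)
  have d1: "(\<gamma> has_vector_derivative \<gamma>' t) (at t)" if t: "t \<in> {-\<epsilon><..<\<epsilon>}" for t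
  proof -
    note y = inV[OF t]
    have "((\<lambda>t. t *\<^sub>R \<xi>) has_vector_derivative \<xi>) (at t)"
      by (auto intro!: derivative_eq_intros)
    from has_vector_derivative_compose[OF this k[OF y]]
    have "(\<gamma> has_vector_derivative k' (t *\<^sub>R \<xi>) \<xi>) (at t)"
      by (simp add: \<gamma>_def[abs_def])
    moreover have "\<gamma>' t \<bullet> g (k (t *\<^sub>R \<xi>)) = 0"
      "\<gamma>' t \<bullet> g x = - (\<xi> \<bullet> g (k (t *\<^sub>R \<xi>))) / (w \<bullet> g (k (t *\<^sub>R \<xi>)))"
      using gkw[OF y] assms(4) gw
      by (simp_all add: \<gamma>'_def \<gamma>_def inner_diff_left inner_commute[of "g x" w])
    then have "\<Psi>' (k (t *\<^sub>R \<xi>)) (\<gamma>' t) = \<xi>"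
      by (simp add: \<Psi>' \<gamma>'_def \<gamma>_def)
    then have "k' (t *\<^sub>R \<xi>) \<xi> = \<gamma>' t"
      using bij[OF y] k'[OF y] by (metis bij_inv_eq_iff)
    ultimately show ?thesis by simp
  qed
  have d2: "(\<gamma>' has_vector_derivative c t *\<^sub>R w) (at t)" if t: "t \<in> {-\<epsilon><..<\<epsilon>}" for t
  proof -
    have gd: "((\<lambda>t. g (\<gamma> t)) has_vector_derivative H (\<gamma> t) (\<gamma>' t)) (at t)"
      by (rule has_vector_derivative_compose[OF d1[OF t]])
        (use kU[OF inV[OF t]] D(6) in \<open>auto simp: \<gamma>_def\<close>)
    have in1: "((\<lambda>t. v \<bullet> g (\<gamma> t)) has_real_derivative v \<bullet> H (\<gamma> t) (\<gamma>' t)) (at t)" for v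
      using has_vector_derivative_inner[OF has_vector_derivative_const gd, of v] by simp
    have "w \<bullet> g (\<gamma> t) \<noteq> 0" using gkw inV[OF t] by (simp add: \<gamma>_def)
    from DERIV_divide[OF in1 in1 this]
    have "((\<lambda>t. (\<xi> \<bullet> g (\<gamma> t)) / (w \<bullet> g (\<gamma> t))) has_real_derivative - c t) (at t)"
      by (simp only: c_def minus_minus)
    from has_vector_derivative_diff[OF has_vector_derivative_const
        has_vector_derivative_scaleR[OF this has_vector_derivative_const], of \<xi> w]
    show ?thesis unfolding \<gamma>'_def by simp
  qed
  have c\<gamma>: "continuous_on {-\<epsilon><..<\<epsilon>} \<gamma>" and c\<gamma>': "continuous_on {-\<epsilon><..<\<epsilon>} \<gamma>'"
    using d1 d2 by (meson continuous_at_imp_continuous_on has_vector_derivative_continuous)+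
  have \<gamma>U: "\<gamma> ` {-\<epsilon><..<\<epsilon>} \<subseteq> U"
    using kU inV by (auto simp: \<gamma>_def)
  have cg: "continuous_on {-\<epsilon><..<\<epsilon>} (\<lambda>t. g (\<gamma> t))"
    by (rule continuous_on_compose2[OF D(7) c\<gamma> \<gamma>U])
  have cH: "continuous_on {-\<epsilon><..<\<epsilon>} (\<lambda>t. H (\<gamma> t))"
    by (rule continuous_on_compose2[OF D(2) c\<gamma> \<gamma>U])
  have "w \<bullet> g (\<gamma> t) \<noteq> 0" if "t \<in> {-\<epsilon><..<\<epsilon>}" for t
    using gkw[OF inV[OF that]] by (simp add: \<gamma>_def)
  then have "continuous_on {-\<epsilon><..<\<epsilon>} c"
    unfolding c_def using cg cH c\<gamma>' by (intro continuous_intros) auto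
  then have "continuous_on {-\<epsilon><..<\<epsilon>} (\<lambda>t. c t *\<^sub>R w)"
    by (intro continuous_intros)
  moreover have "\<gamma> t \<in> S" if "t \<in> {-\<epsilon><..<\<epsilon>}" for t
    using fk[OF inV[OF that]] kU[OF inV[OF that]] D(3) gs by (auto simp: \<gamma>_def)
  moreover have "\<gamma> 0 = x" "\<gamma>' 0 = \<xi>"
    using k0 assms(4) by (auto simp: \<gamma>_def \<gamma>'_def)
  ultimately have "curve_on S \<gamma> x \<xi> (c 0 *\<^sub>R w)"
    unfolding curve_on_def using \<open>0 < \<epsilon>\<close> d1 d2
    by - (rule exI[of _ \<gamma>'], rule exI[of _ "\<lambda>t. c t *\<^sub>R w"], rule exI[of _ \<epsilon>], intro conjI ballI refl)
  then show ?thesis unfolding w_def by (metis scaleR_scaleR)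
qed

lemma tangent_space_level_chart:
  assumes "level_chart S U f g H" and "x \<in> S" "x \<in> U"
  shows "tangent_space S x = {\<xi>. \<xi> \<bullet> g x = 0}"
  unfolding tangent_space_def
  using curve_in_level_chart(1)[OF assms(1,3)] curve_in_level_chart_exists[OF assms] by blast

section \<open>Normals and curvature of the hypersurface\<close>

lemma orthogonal_complement_normal:
  fixes a n :: "'a::real_inner"
  assumes "\<And>w. w \<bullet> n = 0 \<Longrightarrow> a \<bullet> w = 0"
  shows "a = ((a \<bullet> n) / (n \<bullet> n)) *\<^sub>R n"
proof -
  define b where "b = a - ((a \<bullet> n) / (n \<bullet> n)) *\<^sub>R n"
  have "b \<bullet> n = 0" by (cases "n = 0") (simp_all add: b_def inner_diff_left)
  moreover from this have "a \<bullet> b = 0" by (rule assms)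
  ultimately have "(a - ((a \<bullet> n) / (n \<bullet> n)) *\<^sub>R n) \<bullet> b = 0"
    by (simp add: inner_diff_left inner_commute[of n b])
  then have "b \<bullet> b = 0" by (simp only: b_def)
  then show ?thesis by (simp add: b_def)
qed

lemma tangent_projection_level_chart:
  assumes "level_chart S U f g H" and "x \<in> S" "x \<in> U"
  shows "tangent_projection S x u = u - ((u \<bullet> g x) / (g x \<bullet> g x)) *\<^sub>R g x"
  unfolding tangent_projection_def tangent_space_level_chart[OF assms]
proof (rule the_equality, intro conjI ballI)
  have "g x \<noteq> 0" using level_chartD(5)[OF assms(1,3)] .
  then show "u - ((u \<bullet> g x) / (g x \<bullet> g x)) *\<^sub>R g x \<in> {\<xi>. \<xi> \<bullet> g x = 0}"
    by (simp add: inner_diff_left)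
  show "orthogonal (u - (u - ((u \<bullet> g x) / (g x \<bullet> g x)) *\<^sub>R g x)) w"
    if "w \<in> {\<xi>. \<xi> \<bullet> g x = 0}" for w
    using that by (simp add: orthogonal_def inner_commute)
  fix v assume v: "v \<in> {\<xi>. \<xi> \<bullet> g x = 0} \<and> (\<forall>w\<in>{\<xi>. \<xi> \<bullet> g x = 0}. orthogonal (u - v) w)"
  then have "u - v = (((u - v) \<bullet> g x) / (g x \<bullet> g x)) *\<^sub>R g x"
    by (intro orthogonal_complement_normal) (auto simp: orthogonal_def)
  then show "v = u - ((u \<bullet> g x) / (g x \<bullet> g x)) *\<^sub>R g x"
    using v by (simp add: inner_diff_left algebra_simps)
qed

text \<open>A curve on the boundary stays on one side of a supporting hyperplane at \<open>x\<close>, so along it the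
  supporting functional has a minimum at \<open>x\<close> and vanishes on all tangent vectors. Hence the
  supporting functional is a multiple of the gradient.\<close>

lemma supporting_normal_level_chart:
  assumes "convex K" and z: "z \<in> interior K"
    and chart: "level_chart (frontier K) U f g H" and x: "x \<in> frontier K" "x \<in> U"
  obtains c where "c \<noteq> 0" "\<And>y. y \<in> closure K \<Longrightarrow> 0 \<le> (y - x) \<bullet> (c *\<^sub>R g x)"
    "\<And>y. y \<in> interior K \<Longrightarrow> 0 < (y - x) \<bullet> (c *\<^sub>R g x)"
proof -
  have ri: "rel_interior K = interior K"
    using z by (metis empty_iff rel_interior_nonempty_interior)
  have x': "x \<in> closure K" "x \<notin> rel_interior K"
    using x ri by (auto simp: frontier_def)
  from supporting_hyperplane_relative_frontier[OF \<open>convex K\<close> x'] obtain a where "a \<noteq> 0"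
    and a: "\<And>y. y \<in> closure K \<Longrightarrow> a \<bullet> x \<le> a \<bullet> y"
    and a': "\<And>y. y \<in> rel_interior K \<Longrightarrow> a \<bullet> x < a \<bullet> y"
    by metis
  have "a \<bullet> \<xi> = 0" if "\<xi> \<bullet> g x = 0" for \<xi>
  proof -
    from curve_in_level_chart_exists[OF chart x that] obtain \<gamma> b
      where "curve_on (frontier K) \<gamma> x \<xi> b" by blast
    then obtain \<epsilon> \<gamma>' where "0 < \<epsilon>" and "\<gamma> 0 = x" "\<gamma>' 0 = \<xi>"
      and c: "\<forall>t\<in>{-\<epsilon><..<\<epsilon>}. \<gamma> t \<in> frontier K \<and> (\<gamma> has_vector_derivative \<gamma>' t) (at t)"
      unfolding curve_on_def by metis
    then have "(\<gamma> has_vector_derivative \<xi>) (at 0)" by auto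
    from has_vector_derivative_inner[OF has_vector_derivative_const this, of a]
    have "((\<lambda>t. a \<bullet> \<gamma> t) has_real_derivative a \<bullet> \<xi>) (at 0)" by simp
    moreover have "a \<bullet> \<gamma> 0 \<le> a \<bullet> \<gamma> t" if "\<bar>0 - t\<bar> < \<epsilon>" for t
    proof -
      have "t \<in> {-\<epsilon><..<\<epsilon>}" using that by auto
      then show ?thesis using a c \<open>\<gamma> 0 = x\<close> by (auto simp: frontier_def)
    qed
    ultimately show ?thesis using DERIV_local_min[OF _ \<open>0 < \<epsilon>\<close>] by blast
  qed
  from orthogonal_complement_normal[OF this] obtain c where c: "a = c *\<^sub>R g x" by auto
  show thesis
  proof (rule that)
    show "c \<noteq> 0" using \<open>a \<noteq> 0\<close> c by auto
    show "0 \<le> (y - x) \<bullet> (c *\<^sub>R g x)" if "y \<in> closure K" for y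
      using a[OF that] unfolding c[symmetric] by (simp add: inner_diff_left inner_commute[of a])
    show "0 < (y - x) \<bullet> (c *\<^sub>R g x)" if "y \<in> interior K" for y
      using a'[of y] that ri unfolding c[symmetric] by (simp add: inner_diff_left inner_commute[of a])
  qed
qed

text \<open>The sign of \<open>f\<close> can be chosen so that the gradient points to a fixed interior point \<open>z\<close>. It
  then does so on a whole neighbourhood, which gives the inward normal there without any further
  choice of sign.\<close>

lemma inward_level_chart:
  assumes "convex K" and z: "z \<in> interior K" and "C2_hypersurface (frontier K)" and p: "p \<in> frontier K"
  obtains U f g H where "level_chart (frontier K) U f g H" "p \<in> U"
    "\<And>x. x \<in> U \<Longrightarrow> 0 < (z - x) \<bullet> g x"
proof -
  note conclude = that
  have shrink: thesis
    if chart: "level_chart (frontier K) U f g H" and "p \<in> U" "0 < (z - p) \<bullet> g p" for U f g H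
  proof (rule conclude)
    note D = level_chartD[OF chart]
    define V where "V = {x \<in> U. 0 < (z - x) \<bullet> g x}"
    have "open V"
    proof -
      have "continuous_on U (\<lambda>x. (z - x) \<bullet> g x)" using D(7) by (intro continuous_intros)
      from continuous_open_preimage[OF this D(1) open_greaterThan[of 0]]
      show ?thesis by (auto simp: V_def vimage_def Int_def)
    qed
    moreover have "continuous_on V H" using D(2) by (rule continuous_on_subset) (auto simp: V_def)
    moreover have "frontier K \<inter> V = {x \<in> V. f x = 0}" using D(3) by (auto simp: V_def)
    ultimately show "level_chart (frontier K) V f g H"
      using chart by (auto simp: level_chart_def V_def)
    show "p \<in> V" using that by (simp add: V_def)
    show "0 < (z - x) \<bullet> g x" if "x \<in> V" for x using that by (simp add: V_def)
  qed
  obtain U f g H where chart: "level_chart (frontier K) U f g H" and "p \<in> U"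
    using C2_hypersurface_chart[OF assms(3) p] by metis
  obtain c where "0 < (z - p) \<bullet> (c *\<^sub>R g p)"
    using supporting_normal_level_chart[OF assms(1) z chart p \<open>p \<in> U\<close>] z by metis
  then have "0 < (z - p) \<bullet> g p \<or> 0 < (z - p) \<bullet> - g p" by (auto simp: zero_less_mult_iff)
  then show thesis
    using shrink[OF chart \<open>p \<in> U\<close>] shrink[OF level_chart_uminus[OF chart] \<open>p \<in> U\<close>] by blast
qed

lemma inward_normal_level_chart:
  assumes "convex K" and z: "z \<in> interior K"
    and chart: "level_chart (frontier K) U f g H" and x: "x \<in> frontier K" "x \<in> U"
    and zg: "0 < (z - x) \<bullet> g x"
  shows "inward_normal K x = sgn (g x)"
    and "\<And>y. y \<in> interior K \<Longrightarrow> 0 < (y - x) \<bullet> g x"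
proof -
  obtain c where c: "c \<noteq> 0" "\<And>y. y \<in> closure K \<Longrightarrow> 0 \<le> (y - x) \<bullet> (c *\<^sub>R g x)"
    "\<And>y. y \<in> interior K \<Longrightarrow> 0 < (y - x) \<bullet> (c *\<^sub>R g x)"
    using supporting_normal_level_chart[OF assms(1-5)] by metis
  have "c > 0" using c(3)[OF z] zg by (simp add: zero_less_mult_iff)
  then show "0 < (y - x) \<bullet> g x" if "y \<in> interior K" for y
    using c(3)[OF that] by (simp add: zero_less_mult_iff)
  have g0: "g x \<noteq> 0" using zg by auto
  show "inward_normal K x = sgn (g x)"
    unfolding inward_normal_def tangent_space_level_chart[OF chart x]
  proof (rule the_equality, intro conjI ballI)
    show "norm (sgn (g x)) = 1" using g0 by (simp add: norm_sgn)
    show "orthogonal (sgn (g x)) w" if "w \<in> {\<xi>. \<xi> \<bullet> g x = 0}" for w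
      using that by (simp add: orthogonal_def sgn_div_norm inner_commute)
    show "0 \<le> (y - x) \<bullet> sgn (g x)" if "y \<in> K" for y
      using c(2)[of y] \<open>c > 0\<close> that closure_subset[of K]
      by (auto simp: sgn_div_norm zero_le_mult_iff)
    fix \<nu> assume \<nu>: "norm \<nu> = 1 \<and> (\<forall>w\<in>{\<xi>. \<xi> \<bullet> g x = 0}. orthogonal \<nu> w) \<and> (\<forall>y\<in>K. 0 \<le> (y - x) \<bullet> \<nu>)"
    define b where "b = (\<nu> \<bullet> g x) / (g x \<bullet> g x)"
    have b: "\<nu> = b *\<^sub>R g x"
      unfolding b_def using \<nu> by (intro orthogonal_complement_normal) (auto simp: orthogonal_def)
    have "0 \<le> (z - x) \<bullet> \<nu>" using \<nu> z interior_subset[of K] by blast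
    then have "b \<ge> 0" using zg unfolding b by (simp add: zero_le_mult_iff)
    moreover have "\<bar>b\<bar> * norm (g x) = 1" using \<nu> b by (metis norm_scaleR)
    ultimately have "b = inverse (norm (g x))" using g0 by (simp add: field_simps)
    then show "\<nu> = sgn (g x)" using b by (simp add: sgn_div_norm)
  qed
qed

lemma second_fundamental_form_level_chart:
  assumes "convex K" and z: "z \<in> interior K"
    and chart: "level_chart (frontier K) U f g H" and x: "x \<in> frontier K" "x \<in> U"
    and zg: "0 < (z - x) \<bullet> g x" and \<xi>: "\<xi> \<bullet> g x = 0"
  shows "second_fundamental_form K x \<xi> = - (\<xi> \<bullet> H x \<xi>) / norm (g x)"
  unfolding second_fundamental_form_def inward_normal_level_chart(1)[OF assms(1-6)]
proof (rule the_equality)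
  have *: "a \<bullet> sgn (g x) = - (\<xi> \<bullet> H x \<xi>) / norm (g x)" if "curve_on (frontier K) \<gamma> x \<xi> a" for \<gamma> a
    using curve_in_level_chart(2)[OF chart x(2) that] by (simp add: sgn_div_norm divide_inverse)
  show "\<exists>\<gamma> a. curve_on (frontier K) \<gamma> x \<xi> a \<and> - (\<xi> \<bullet> H x \<xi>) / norm (g x) = a \<bullet> sgn (g x)"
    using curve_in_level_chart_exists[OF chart x \<xi>] * by metis
  show "q = - (\<xi> \<bullet> H x \<xi>) / norm (g x)"
    if "\<exists>\<gamma> a. curve_on (frontier K) \<gamma> x \<xi> a \<and> q = a \<bullet> sgn (g x)" for q
    using that * by metis
qed

section \<open>Second variation of length\<close>

lemma deriv_deriv_eqI:
  fixes F :: "real \<Rightarrow> real"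
  assumes "eventually (\<lambda>t. (F has_real_derivative F' t) (at t)) (nhds t0)"
    and "(F' has_real_derivative D) (at t0)"
  shows "deriv (deriv F) t0 = D"
proof -
  have "eventually (\<lambda>t. deriv F t = F' t) (nhds t0)"
    using assms(1) by (rule eventually_mono) (rule DERIV_imp_deriv)
  then have "deriv (deriv F) t0 = deriv F' t0" by (intro deriv_cong_ev) auto
  then show ?thesis using DERIV_imp_deriv[OF assms(2)] by simp
qed

text \<open>The distance to a point \<open>y\<close> has gradient \<open>- unit_direction x y\<close>, and its Hessian is the
  projection orthogonal to that direction divided by the distance.\<close>

lemma distance_along_curve:
  assumes "curve_on S \<gamma> x \<xi> a" and "y \<noteq> x"
  obtains N' where
    "eventually (\<lambda>t. ((\<lambda>t. norm (\<gamma> t - y)) has_real_derivative N' t) (at t)) (nhds 0)"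
    "(N' has_real_derivative
       ((norm \<xi>)\<^sup>2 - (\<xi> \<bullet> unit_direction x y)\<^sup>2) / norm (y - x) - a \<bullet> unit_direction x y) (at 0)"
proof -
  from assms obtain \<gamma>' \<gamma>'' \<epsilon> where "0 < \<epsilon>"
    and c: "\<And>t. t \<in> {-\<epsilon><..<\<epsilon>} \<Longrightarrow> (\<gamma> has_vector_derivative \<gamma>' t) (at t)"
      "\<And>t. t \<in> {-\<epsilon><..<\<epsilon>} \<Longrightarrow> (\<gamma>' has_vector_derivative \<gamma>'' t) (at t)"
    and i: "\<gamma> 0 = x" "\<gamma>' 0 = \<xi>" "\<gamma>'' 0 = a"
    unfolding curve_on_def by metis
  define N' where "N' t = (\<gamma>' t \<bullet> (\<gamma> t - y)) / norm (\<gamma> t - y)" for t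
  have N: "((\<lambda>t. norm (\<gamma> t - y)) has_real_derivative N' t) (at t)"
    if t: "t \<in> {-\<epsilon><..<\<epsilon>}" "\<gamma> t \<noteq> y" for t
  proof -
    have "((\<lambda>t. \<gamma> t - y) has_vector_derivative \<gamma>' t) (at t)"
      using has_vector_derivative_diff[OF c(1)[OF t(1)] has_vector_derivative_const] by simp
    from has_vector_derivative_compose[OF this has_derivative_norm] t(2)
    show ?thesis
      by (simp add: N'_def has_real_derivative_iff_has_vector_derivative sgn_div_norm divide_inverse
          mult.commute)
  qed
  have "isCont \<gamma> 0" using c(1)[of 0] \<open>0 < \<epsilon>\<close> by (auto intro: has_vector_derivative_continuous)
  then have "(\<gamma> \<longlongrightarrow> x) (nhds 0)"
    using i by (metis continuous_at tendsto_at_iff_tendsto_nhds)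
  then have "eventually (\<lambda>t. \<gamma> t \<noteq> y) (nhds 0)"
    using \<open>y \<noteq> x\<close> by (metis tendsto_imp_eventually_ne)
  moreover have "eventually (\<lambda>t. t \<in> {-\<epsilon><..<\<epsilon>}) (nhds 0)"
    using \<open>0 < \<epsilon>\<close> by (intro eventually_nhds_in_open) auto
  ultimately have ev: "eventually (\<lambda>t. ((\<lambda>t. norm (\<gamma> t - y)) has_real_derivative N' t) (at t)) (nhds 0)"
    by eventually_elim (rule N)
  have n0: "norm (x - y) \<noteq> 0" using \<open>y \<noteq> x\<close> by simp
  have "((\<lambda>t. \<gamma> t - y) has_vector_derivative \<xi>) (at 0)"
    using has_vector_derivative_diff[OF c(1)[of 0] has_vector_derivative_const] \<open>0 < \<epsilon>\<close> i by simp
  from has_vector_derivative_inner[OF c(2)[of 0] this] \<open>0 < \<epsilon>\<close> i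
  have "((\<lambda>t. \<gamma>' t \<bullet> (\<gamma> t - y)) has_real_derivative \<xi> \<bullet> \<xi> + a \<bullet> (x - y)) (at 0)" by simp
  from DERIV_divide[OF this N[of 0]] \<open>0 < \<epsilon>\<close> i n0 \<open>y \<noteq> x\<close>
  have "(N' has_real_derivative
      ((\<xi> \<bullet> \<xi> + a \<bullet> (x - y)) * norm (x - y) - (\<xi> \<bullet> (x - y)) * N' 0) / (norm (x - y) * norm (x - y))) (at 0)"
    by (simp add: N'_def[abs_def])
  also have "((\<xi> \<bullet> \<xi> + a \<bullet> (x - y)) * norm (x - y) - (\<xi> \<bullet> (x - y)) * N' 0) / (norm (x - y) * norm (x - y))
     = ((norm \<xi>)\<^sup>2 - (\<xi> \<bullet> unit_direction x y)\<^sup>2) / norm (y - x) - a \<bullet> unit_direction x y"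
  proof -
    define l where "l = norm (x - y)"
    have e: "v \<bullet> unit_direction x y = - (v \<bullet> (x - y)) / l" for v
      unfolding unit_direction_def l_def norm_minus_commute[of y x]
      by (simp add: divide_inverse inner_diff_right algebra_simps)
    have "l \<noteq> 0" using n0 l_def by simp
    then show ?thesis
      unfolding N'_def i e norm_minus_commute[of y x] l_def[symmetric] power2_norm_eq_inner
      by (simp add: field_simps power2_eq_square)
  qed
  finally show thesis using ev that by blast
qed

text \<open>The contribution of the leg from \<open>x\<close> to \<open>y\<close> to the second variation, where \<open>g\<close> and \<open>H\<close> are
  the gradient and the Hessian of the local equation at \<open>x\<close>. If the gradient points inwards, if
  \<open>\<phi>\<close> is the angle between the leg and the tangent space and \<open>l\<close> its length, then the second
  summand is minus \<open>sin \<phi>\<close> times the second fundamental form of \<open>\<xi>\<close>, and for \<open>\<xi>\<close> parallel to the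
  tangential part of the leg the first one is \<open>|\<xi>|\<^sup>2 (sin \<phi>)\<^sup>2 / l\<close>.\<close>

definition leg_variation ::
    "'a::euclidean_space \<Rightarrow> ('a \<Rightarrow>\<^sub>L 'a) \<Rightarrow> 'a \<Rightarrow> 'a \<Rightarrow> 'a \<Rightarrow> real" where
  "leg_variation g H x y \<xi> =
     ((norm \<xi>)\<^sup>2 - (\<xi> \<bullet> unit_direction x y)\<^sup>2) / norm (y - x) +
     (\<xi> \<bullet> blinfun_apply H \<xi>) * (unit_direction x y \<bullet> g) / (norm g)\<^sup>2"

text \<open>A normal acceleration is determined by the velocity, which makes the second variation
  independent of the curve. Its inner product with the direction of a leg yields the curvature term
  of that leg.\<close>

lemma second_variation_length:
  assumes chart: "level_chart S U f g H" and x: "x \<in> S" "x \<in> U"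
    and \<xi>: "\<xi> \<bullet> g x = 0" and "xm \<noteq> x" "x1 \<noteq> x"
  shows "second_variation S (\<Phi>00 xm x1) x \<xi> =
    leg_variation (g x) (H x) x xm \<xi> + leg_variation (g x) (H x) x x1 \<xi>"
  (is "_ = ?q")
  unfolding second_variation_def tangent_space_level_chart[OF chart x]
proof (rule the_equality)
  have g0: "g x \<noteq> 0" using level_chartD(5)[OF chart x(2)] .
  have *: "deriv (deriv (\<lambda>t. \<Phi>00 xm x1 (\<gamma> t))) 0 = ?q"
    if \<gamma>: "curve_on S \<gamma> x \<xi> a" and n: "\<forall>w\<in>{\<xi>. \<xi> \<bullet> g x = 0}. orthogonal a w" for \<gamma> a
  proof -
    have "a = ((a \<bullet> g x) / (g x \<bullet> g x)) *\<^sub>R g x"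
      using n by (intro orthogonal_complement_normal) (auto simp: orthogonal_def)
    then have a: "a = (- (\<xi> \<bullet> H x \<xi>) / (norm (g x))\<^sup>2) *\<^sub>R g x"
      using curve_in_level_chart(2)[OF chart x(2) \<gamma>] by (simp add: power2_norm_eq_inner)
    obtain M' where M: "eventually (\<lambda>t. ((\<lambda>t. norm (\<gamma> t - xm)) has_real_derivative M' t) (at t)) (nhds 0)"
      "(M' has_real_derivative
         ((norm \<xi>)\<^sup>2 - (\<xi> \<bullet> unit_direction x xm)\<^sup>2) / norm (xm - x) - a \<bullet> unit_direction x xm) (at 0)"
      using distance_along_curve[OF \<gamma> \<open>xm \<noteq> x\<close>] .
    obtain N' where N: "eventually (\<lambda>t. ((\<lambda>t. norm (\<gamma> t - x1)) has_real_derivative N' t) (at t)) (nhds 0)"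
      "(N' has_real_derivative
         ((norm \<xi>)\<^sup>2 - (\<xi> \<bullet> unit_direction x x1)\<^sup>2) / norm (x1 - x) - a \<bullet> unit_direction x x1) (at 0)"
      using distance_along_curve[OF \<gamma> \<open>x1 \<noteq> x\<close>] .
    have "eventually (\<lambda>t. ((\<lambda>t. \<Phi>00 xm x1 (\<gamma> t)) has_real_derivative M' t + N' t) (at t)) (nhds 0)"
      using M(1) N(1) unfolding \<Phi>00_def norm_minus_commute[of xm]
      by eventually_elim (rule DERIV_add)
    from deriv_deriv_eqI[OF this DERIV_add[OF M(2) N(2)]]
    show ?thesis unfolding leg_variation_def a
      by (simp add: inner_commute[of "g x" "unit_direction x _"] algebra_simps)
  qed
  show "\<exists>\<gamma> a. curve_on S \<gamma> x \<xi> a \<and> (\<forall>w\<in>{\<xi>. \<xi> \<bullet> g x = 0}. orthogonal a w) \<and>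
      ?q = deriv (deriv (\<lambda>t. \<Phi>00 xm x1 (\<gamma> t))) 0"
  proof -
    obtain \<gamma> c where \<gamma>: "curve_on S \<gamma> x \<xi> (c *\<^sub>R g x)"
      using curve_in_level_chart_exists[OF chart x \<xi>] by metis
    moreover have n: "\<forall>w\<in>{\<xi>. \<xi> \<bullet> g x = 0}. orthogonal (c *\<^sub>R g x) w"
      by (auto simp: orthogonal_def inner_commute)
    ultimately show ?thesis using *[OF \<gamma> n] by metis
  qed
  show "q = ?q" if "\<exists>\<gamma> a. curve_on S \<gamma> x \<xi> a \<and> (\<forall>w\<in>{\<xi>. \<xi> \<bullet> g x = 0}. orthogonal a w) \<and>
      q = deriv (deriv (\<lambda>t. \<Phi>00 xm x1 (\<gamma> t))) 0" for q
    using that * by metis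
qed

section \<open>Sign of the contribution of a single leg\<close>

text \<open>As \<open>f\<close> vanishes at both ends of a chord, its first order Taylor term is minus the remainder of
  second order. For a short chord this says that the sine of the angle with the tangent space,
  divided by the length, is about half the normal curvature.\<close>

lemma chord_taylor:
  assumes chart: "level_chart S U f g H" and ball: "ball p r \<subseteq> U"
    and x: "x \<in> S \<inter> ball p r" and y: "y \<in> S \<inter> ball p r"
  obtains z where "z \<in> ball p r" "(y - x) \<bullet> g x = - ((y - x) \<bullet> H z (y - x)) / 2"
proof -
  note D = level_chartD[OF chart]
  define \<sigma> where "\<sigma> t = x + t *\<^sub>R (y - x)" for t :: real
  have \<sigma>: "\<sigma> t \<in> ball p r" if "0 \<le> t" "t \<le> 1" for t
  proof -
    have "\<sigma> t = (1 - t) *\<^sub>R x + t *\<^sub>R y" by (simp add: \<sigma>_def algebra_simps)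
    then show ?thesis using x y that convexD_alt[OF convex_ball, of x p r y t] by auto
  qed
  have d\<sigma>: "(\<sigma> has_vector_derivative (y - x)) (at t)" for t
    unfolding \<sigma>_def by (auto intro!: derivative_eq_intros)
  define \<phi> where "\<phi> m t = (if m = 0 then f (\<sigma> t) else if m = 1 then (y - x) \<bullet> g (\<sigma> t)
      else (y - x) \<bullet> H (\<sigma> t) (y - x))" for m :: nat and t
  have "\<forall>m t. m < 2 \<and> 0 \<le> t \<and> t \<le> 1 \<longrightarrow> DERIV (\<phi> m) t :> \<phi> (Suc m) t"
  proof (intro allI impI)
    fix m :: nat and t :: real assume mt: "m < 2 \<and> 0 \<le> t \<and> t \<le> 1"
    then have u: "\<sigma> t \<in> U" using \<sigma> ball by blast
    consider "m = 0" | "m = 1" using mt by linarith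
    then show "DERIV (\<phi> m) t :> \<phi> (Suc m) t"
    proof cases
      case 1
      then show ?thesis using has_vector_derivative_compose[OF d\<sigma> D(4)[OF u]]
        by (simp add: \<phi>_def[abs_def] has_real_derivative_iff_has_vector_derivative)
    next
      case 2
      have "((\<lambda>t. g (\<sigma> t)) has_vector_derivative H (\<sigma> t) (y - x)) (at t)"
        using has_vector_derivative_compose[OF d\<sigma> D(6)[OF u]] .
      from has_vector_derivative_inner[OF has_vector_derivative_const this, of "y - x"] 2
      show ?thesis by (simp add: \<phi>_def[abs_def])
    qed
  qed
  from Taylor_up[of 2 \<phi> "\<phi> 0" 0 1 0, OF _ _ this] obtain t where t: "0 < t" "t < 1"
    and "\<phi> 0 1 = (\<Sum>m<2. \<phi> m 0 / fact m * (1 - 0) ^ m) + \<phi> 2 t / fact 2 * (1 - 0) ^ 2"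
    by auto
  moreover have "\<phi> 0 1 = 0" "\<phi> 0 0 = 0"
    using x y ball D(3) by (auto simp: \<phi>_def \<sigma>_def)
  ultimately have "\<phi> 1 0 + \<phi> 2 t / 2 = 0" by (simp add: numeral_2_eq_2)
  then have "(y - x) \<bullet> g x = - ((y - x) \<bullet> H (\<sigma> t) (y - x)) / 2"
    by (simp add: \<phi>_def \<sigma>_def)
  then show thesis using that \<sigma>[of t] t by auto
qed

lemma quadratic_form_diff:
  fixes A B :: "'a::real_inner \<Rightarrow>\<^sub>L 'a"
  assumes "norm u = 1" "norm v = 1"
  shows "\<bar>u \<bullet> A u - v \<bullet> B v\<bar> \<le> norm (A - B) + 2 * norm B * norm (u - v)"
proof -
  have b: "\<bar>a \<bullet> T c\<bar> \<le> norm a * norm T * norm c" for a c :: 'a and T :: "'a \<Rightarrow>\<^sub>L 'a"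
    using Cauchy_Schwarz_ineq2[of a "T c"] mult_left_mono[OF norm_blinfun[of T c], of "norm a"]
    by (simp add: mult.assoc)
  have "u \<bullet> A u - v \<bullet> B v = u \<bullet> (A - B) u + (u - v) \<bullet> B u + v \<bullet> B (u - v)"
    by (simp add: blinfun.diff_left blinfun.diff_right inner_diff_left inner_diff_right)
  then show ?thesis
    using b[of u "A - B" u] b[of "u - v" B u] b[of v B "u - v"] assms
    by (simp add: mult.commute[of "norm (u - v)"])
qed

text \<open>The unit tangent vectors over a compact set form a compact set, on which the curvature attains
  its minimum.\<close>

lemma uniformly_negative_definite:
  fixes g :: "'a::euclidean_space \<Rightarrow> 'a"
  assumes "compact C" "continuous_on C g" "continuous_on C H"
    and neg: "\<And>x \<xi>. x \<in> C \<Longrightarrow> \<xi> \<noteq> 0 \<Longrightarrow> \<xi> \<bullet> g x = 0 \<Longrightarrow> \<xi> \<bullet> blinfun_apply (H x) \<xi> < 0"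
  obtains \<kappa> where "0 < \<kappa>"
    "\<And>x w. x \<in> C \<Longrightarrow> norm w = 1 \<Longrightarrow> w \<bullet> g x = 0 \<Longrightarrow> \<kappa> \<le> - (w \<bullet> H x w)"
proof -
  define A where "A = {xw \<in> C \<times> sphere (0::'a) 1. snd xw \<bullet> g (fst xw) = 0}"
  have cg: "continuous_on (C \<times> sphere (0::'a) 1) (\<lambda>xw. g (fst xw))"
    by (rule continuous_on_compose2[OF assms(2)]) (auto intro!: continuous_intros)
  have cH: "continuous_on (C \<times> sphere (0::'a) 1) (\<lambda>xw. H (fst xw))"
    by (rule continuous_on_compose2[OF assms(3)]) (auto intro!: continuous_intros)
  have cs: "continuous_on (C \<times> sphere (0::'a) 1) snd" by (intro continuous_intros)
  have comp: "compact (C \<times> sphere (0::'a) 1)"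
    by (intro compact_Times assms(1) compact_sphere)
  have "closedin (top_of_set (C \<times> sphere (0::'a) 1)) A"
    unfolding A_def
    by (rule continuous_closedin_preimage_constant) (intro continuous_on_inner cs cg)
  then have "compact A" using comp closedin_compact by blast
  have cQ: "continuous_on A (\<lambda>xw. - (snd xw \<bullet> H (fst xw) (snd xw)))"
    by (rule continuous_on_subset[of "C \<times> sphere 0 1"])
      (intro continuous_on_minus continuous_on_inner cs cH
        bounded_bilinear.continuous_on[OF bounded_bilinear_blinfun_apply], auto simp: A_def)
  show thesis
  proof (cases "A = {}")
    case True
    then show ?thesis using that[of 1] by (auto simp: A_def)
  next
    case False
    from continuous_attains_inf[OF \<open>compact A\<close> False cQ] obtain a where "a \<in> A"
      and a: "\<And>b. b \<in> A \<Longrightarrow> - (snd a \<bullet> H (fst a) (snd a)) \<le> - (snd b \<bullet> H (fst b) (snd b))"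
      by blast
    show ?thesis
    proof (rule that)
      show "0 < - (snd a \<bullet> H (fst a) (snd a))"
        using \<open>a \<in> A\<close> neg[of "fst a" "snd a"] norm_zero[where 'a='a]
        by (fastforce simp: A_def simp del: norm_zero)
      show "- (snd a \<bullet> H (fst a) (snd a)) \<le> - (w \<bullet> H x w)"
        if "x \<in> C" "norm w = 1" "w \<bullet> g x = 0" for x w
        using a[of "(x, w)"] that by (auto simp: A_def)
    qed
  qed
qed

lemma norm_tangential_part:
  fixes e n :: "'a::real_inner"
  assumes "norm e = 1" "norm n = 1" and v: "v = e - (e \<bullet> n) *\<^sub>R n"
  shows "v \<bullet> n = 0" "v \<bullet> e = (norm v)\<^sup>2" "(norm v)\<^sup>2 = 1 - (e \<bullet> n)\<^sup>2"
proof -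
  have e: "e \<bullet> e = 1" and n: "n \<bullet> n = 1" using assms by (simp_all add: norm_eq_1)
  show vn: "v \<bullet> n = 0" by (simp add: v inner_diff_left n)
  have "v \<bullet> (e - (e \<bullet> n) *\<^sub>R n) = v \<bullet> e" by (simp add: inner_diff_right vn)
  then show ve: "v \<bullet> e = (norm v)\<^sup>2" unfolding v[symmetric] by (simp add: power2_norm_eq_inner)
  have "v \<bullet> e = 1 - (e \<bullet> n)\<^sup>2"
    by (simp add: v inner_diff_left e inner_commute[of n e] power2_eq_square)
  then show "(norm v)\<^sup>2 = 1 - (e \<bullet> n)\<^sup>2" using ve by simp
qed

text \<open>A unit vector \<open>e\<close> that is almost tangent is close to the direction of its tangential part, so
  the curvature in either direction is almost the same.\<close>

lemma sgn_tangential_part_close: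
  fixes e n :: "'a::real_inner"
  assumes "norm e = 1" "norm n = 1" and v: "v = e - (e \<bullet> n) *\<^sub>R n" and "v \<noteq> 0"
  shows "norm (e - sgn v) \<le> 2 * \<bar>e \<bullet> n\<bar>"
proof -
  note T = norm_tangential_part[OF assms(1-3)]
  have "norm v \<le> 1" by (rule power2_le_imp_le) (simp_all add: T(3))
  have "norm (e - v) = \<bar>e \<bullet> n\<bar>" using v assms(2) by simp
  moreover have "norm (v - sgn v) = 1 - norm v"
  proof -
    have "v - sgn v = - (1 - norm v) *\<^sub>R sgn v"
      using \<open>v \<noteq> 0\<close> by (simp add: sgn_div_norm algebra_simps)
    then show ?thesis using \<open>norm v \<le> 1\<close> \<open>v \<noteq> 0\<close> by (simp add: norm_sgn)
  qed
  moreover have "1 - norm v \<le> \<bar>e \<bullet> n\<bar>"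
    using assms(1) \<open>norm (e - v) = _\<close> norm_triangle_ineq2[of e v] by simp
  ultimately show ?thesis
    using norm_triangle_ineq[of "e - v" "v - sgn v"] by simp
qed

lemma norm_unit_direction: "x \<noteq> y \<Longrightarrow> norm (unit_direction x y) = 1"
  by (simp add: unit_direction_def)

text \<open>For \<open>\<xi>\<close> orthogonal to the leg only the curvature term carries the factor \<open>s\<close>, the sine of the
  angle between the leg and the tangent space, so \<open>|\<xi>|\<^sup>2 / l\<close> dominates it when \<open>s\<close> is small.\<close>

lemma leg_variation_pos:
  fixes g :: "'a::euclidean_space" and H :: "'a \<Rightarrow>\<^sub>L 'a"
  assumes "g \<noteq> 0" "y \<noteq> x" and s: "s = unit_direction x y \<bullet> sgn g" "0 < s"
    and small: "norm H * s * norm (y - x) < norm g"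
    and "\<xi> \<noteq> 0" and perp: "\<xi> \<bullet> unit_direction x y = 0"
  shows "0 < leg_variation g H x y \<xi>"
proof -
  define l where "l = norm (y - x)"
  have pos: "0 < l" "0 < norm g" using assms by (auto simp: l_def)
  have eg: "unit_direction x y \<bullet> g = s * norm g"
    using pos by (simp add: s sgn_div_norm)
  have "- (\<xi> \<bullet> H \<xi>) \<le> norm H * (norm \<xi>)\<^sup>2"
    using Cauchy_Schwarz_ineq2[of \<xi> "H \<xi>"] mult_left_mono[OF norm_blinfun[of H \<xi>], of "norm \<xi>"]
    by (simp add: power2_eq_square mult_ac)
  then have "- (\<xi> \<bullet> H \<xi>) * (s * l) \<le> norm H * (norm \<xi>)\<^sup>2 * (s * l)"
    using \<open>0 < s\<close> pos by (intro mult_right_mono) auto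
  also have "\<dots> = (norm \<xi>)\<^sup>2 * (norm H * s * l)" by simp
  also have "\<dots> < (norm \<xi>)\<^sup>2 * norm g"
    using small \<open>\<xi> \<noteq> 0\<close> unfolding l_def by (intro mult_strict_left_mono) auto
  finally have "0 < ((norm \<xi>)\<^sup>2 * norm g + (\<xi> \<bullet> H \<xi>) * s * l) / (l * norm g)"
    using pos by (intro divide_pos_pos mult_pos_pos) (auto simp: algebra_simps)
  also have "\<dots> = leg_variation g H x y \<xi>"
    using pos unfolding leg_variation_def perp eg l_def[symmetric]
    by (simp add: field_simps power2_eq_square)
  finally show ?thesis .
qed

text \<open>Along the tangential part \<open>v\<close> of the leg both terms carry the factor \<open>s\<close>. What remains is to
  compare \<open>s / l\<close> with the normal curvature in the direction of \<open>v\<close>.\<close>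

lemma leg_variation_neg:
  fixes g :: "'a::euclidean_space" and H :: "'a \<Rightarrow>\<^sub>L 'a"
  assumes "g \<noteq> 0" "y \<noteq> x" and s: "s = unit_direction x y \<bullet> sgn g" "0 < s"
    and v: "v = unit_direction x y - s *\<^sub>R sgn g"
    and curv: "s * norm g / norm (y - x) < - (sgn v \<bullet> H (sgn v))"
    and "c *\<^sub>R v \<noteq> 0"
  shows "leg_variation g H x y (c *\<^sub>R v) < 0"
proof -
  define l w where "l = norm (y - x)" and "w = sgn v"
  have pos: "0 < l" "0 < norm g" using assms by (auto simp: l_def)
  have eg: "unit_direction x y \<bullet> g = s * norm g"
    using pos by (simp add: s sgn_div_norm)
  have n: "norm (unit_direction x y) = 1" "norm (sgn g) = 1"
    using assms(1,2) by (auto simp: norm_unit_direction norm_sgn)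
  note T = norm_tangential_part[OF n v[unfolded s]]
  have vw: "v = norm v *\<^sub>R w" using \<open>c *\<^sub>R v \<noteq> 0\<close> by (simp add: w_def sgn_div_norm)
  have "v \<bullet> H v = (norm v)\<^sup>2 * (w \<bullet> H w)"
    by (subst (1 2) vw) (simp add: blinfun.scaleR_right power2_eq_square)
  then have "leg_variation g H x y (c *\<^sub>R v) =
      (c\<^sup>2 * (norm v)\<^sup>2 - (c * (norm v)\<^sup>2)\<^sup>2) / l + c\<^sup>2 * ((norm v)\<^sup>2 * (w \<bullet> H w)) * s / norm g"
    using pos unfolding leg_variation_def eg l_def[symmetric] inner_scaleR_left T(2)
    by (simp add: blinfun.scaleR_right power_mult_distrib) (simp add: power2_eq_square)
  also have "c\<^sup>2 * (norm v)\<^sup>2 - (c * (norm v)\<^sup>2)\<^sup>2 = c\<^sup>2 * (norm v)\<^sup>2 * s\<^sup>2"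
  proof -
    have "s\<^sup>2 = 1 - (norm v)\<^sup>2" using T(3) unfolding s(1)[symmetric] by simp
    moreover have "c\<^sup>2 * (norm v)\<^sup>2 - (c * (norm v)\<^sup>2)\<^sup>2 = c\<^sup>2 * (norm v)\<^sup>2 * (1 - (norm v)\<^sup>2)"
      by (simp add: power2_eq_square algebra_simps)
    ultimately show ?thesis by simp
  qed
  also have "c\<^sup>2 * (norm v)\<^sup>2 * s\<^sup>2 / l + c\<^sup>2 * ((norm v)\<^sup>2 * (w \<bullet> H w)) * s / norm g =
      c\<^sup>2 * (norm v)\<^sup>2 * s / norm g * (s * norm g / l + w \<bullet> H w)"
    using pos by (simp add: field_simps power2_eq_square)
  also have "\<dots> < 0"
    using curv pos \<open>0 < s\<close> \<open>c *\<^sub>R v \<noteq> 0\<close> unfolding w_def[symmetric] l_def[symmetric]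
    by (intro mult_pos_neg divide_pos_pos mult_pos_pos) auto
  finally show ?thesis .
qed

text \<open>Both comparisons hold uniformly near a point \<open>p\<close> once the angle is small. For the second one,
  legs of length at least \<open>r\<close> cause no problem since \<open>s / l \<le> s / r\<close> is small. For shorter legs
  \<open>s / l\<close> is, up to a small error, half the normal curvature, and half a positive quantity is less
  than the quantity itself.\<close>

lemma leg_variation_signs_near:
  fixes p :: "'a::euclidean_space"
  assumes chart: "level_chart S U f g H" and "compact S" and "p \<in> U"
    and neg: "\<And>x \<xi>. x \<in> S \<inter> U \<Longrightarrow> \<xi> \<noteq> 0 \<Longrightarrow> \<xi> \<bullet> g x = 0 \<Longrightarrow> \<xi> \<bullet> H x \<xi> < 0"
  obtains r \<delta> where "0 < r" "0 < \<delta>"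
    "\<And>x y s \<xi>. x \<in> S \<inter> ball p r \<Longrightarrow> y \<in> S \<Longrightarrow> y \<noteq> x \<Longrightarrow> s = unit_direction x y \<bullet> sgn (g x) \<Longrightarrow>
       0 < s \<Longrightarrow> s < \<delta> \<Longrightarrow> \<xi> \<noteq> 0 \<Longrightarrow> \<xi> \<bullet> unit_direction x y = 0 \<Longrightarrow>
       0 < leg_variation (g x) (H x) x y \<xi>"
    "\<And>x y s v c. x \<in> S \<inter> ball p r \<Longrightarrow> y \<in> S \<Longrightarrow> y \<noteq> x \<Longrightarrow> s = unit_direction x y \<bullet> sgn (g x) \<Longrightarrow>
       0 < s \<Longrightarrow> s < \<delta> \<Longrightarrow> v = unit_direction x y - s *\<^sub>R sgn (g x) \<Longrightarrow> c *\<^sub>R v \<noteq> 0 \<Longrightarrow>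
       leg_variation (g x) (H x) x y (c *\<^sub>R v) < 0"
proof -
  note D = level_chartD[OF chart]
  obtain r0 where r0: "0 < r0" "cball p r0 \<subseteq> U"
    using D(1) \<open>p \<in> U\<close> open_contains_cball by blast
  have cg: "continuous_on (cball p r0) g" and cH: "continuous_on (cball p r0) H"
    using D(2,7) r0 continuous_on_subset by blast+
  have S0: "S \<inter> cball p r0 \<subseteq> cball p r0" "compact (S \<inter> cball p r0)"
    using \<open>compact S\<close> by (auto intro: compact_Int_closed)
  obtain \<kappa> where "0 < \<kappa>" and \<kappa>: "\<And>x w. x \<in> S \<inter> cball p r0 \<Longrightarrow> norm w = 1 \<Longrightarrow> w \<bullet> g x = 0 \<Longrightarrow>
      \<kappa> \<le> - (w \<bullet> H x w)"
  proof (rule uniformly_negative_definite[OF S0(2)])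
    show "continuous_on (S \<inter> cball p r0) g" "continuous_on (S \<inter> cball p r0) H"
      using cg cH S0(1) continuous_on_subset by blast+
  qed (use neg r0 in auto)
  have "bounded (g ` cball p r0)" "bounded (H ` cball p r0)"
    by (intro compact_imp_bounded compact_continuous_image cg cH compact_cball)+
  then obtain G M where "0 < G" "0 < M"
    and "\<forall>v\<in>g ` cball p r0. norm v \<le> G" "\<forall>A\<in>H ` cball p r0. norm A \<le> M"
    unfolding bounded_pos by metis
  then have G: "\<And>x. x \<in> cball p r0 \<Longrightarrow> norm (g x) \<le> G"
    and M: "\<And>x. x \<in> cball p r0 \<Longrightarrow> norm (H x) \<le> M"
    by blast+
  have "continuous_on (cball p r0) (\<lambda>x. norm (g x))" using cg by (intro continuous_intros)
  from continuous_attains_inf[OF compact_cball _ this] r0 obtain q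
    where q: "q \<in> cball p r0" "\<And>x. x \<in> cball p r0 \<Longrightarrow> norm (g q) \<le> norm (g x)" by auto
  define m where "m = norm (g q)"
  have "0 < m" using D(5)[of q] q r0 by (auto simp: m_def)
  obtain B where "0 < B" and B: "\<And>x. x \<in> S \<Longrightarrow> norm x \<le> B"
    using compact_imp_bounded[OF \<open>compact S\<close>] bounded_pos by metis
  have l2B: "norm (y - x) \<le> 2 * B" if "x \<in> S" "y \<in> S" for x y
    using B[OF that(1)] B[OF that(2)] norm_triangle_ineq4[of y x] by linarith
  have "isCont H p" using D(1,2) \<open>p \<in> U\<close> continuous_on_eq_continuous_at by blast
  moreover have "0 < \<kappa> / 8" using \<open>0 < \<kappa>\<close> by simp
  ultimately obtain r1 where "0 < r1" and r1': "\<And>z. dist z p < r1 \<Longrightarrow> dist (H z) (H p) < \<kappa> / 8"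
    unfolding continuous_at_eps_delta by blast
  define r where "r = min r0 r1 / 2"
  have r: "0 < r" "ball p (2 * r) \<subseteq> cball p r0" using r0 \<open>0 < r1\<close> by (auto simp: r_def)
  have Hvar: "norm (H z - H x) \<le> \<kappa> / 4" if "x \<in> ball p (2 * r)" "z \<in> ball p (2 * r)" for x z
  proof -
    have "dist (H z) (H p) < \<kappa> / 8" "dist (H x) (H p) < \<kappa> / 8"
      using that by (intro r1'; simp add: r_def dist_commute)+
    then show ?thesis
      using dist_triangle2[of "H z" "H x" "H p"] by (simp add: dist_norm)
  qed
  \<comment> \<open>The three bounds serve the orthogonal directions, the long legs, and the difference between
    the directions of a short leg and of its tangential part.\<close>
  define \<delta> where "\<delta> = min (m / (2 * M * B)) (min (\<kappa> * r / G) (\<kappa> / (16 * M)))"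
  have "0 < \<delta>"
    using \<open>0 < m\<close> \<open>0 < M\<close> \<open>0 < B\<close> \<open>0 < \<kappa>\<close> \<open>0 < G\<close> r by (simp add: \<delta>_def)
  show thesis
  proof (rule that[OF r(1) \<open>0 < \<delta>\<close>])
    fix x y s and \<xi> :: 'a
    assume x: "x \<in> S \<inter> ball p r" and y: "y \<in> S" "y \<noteq> x"
      and s: "s = unit_direction x y \<bullet> sgn (g x)" "0 < s" "s < \<delta>"
      and \<xi>: "\<xi> \<noteq> 0" "\<xi> \<bullet> unit_direction x y = 0"
    have x0: "x \<in> cball p r0" using x r by (auto simp: subset_iff)
    have "norm (H x) * s * norm (y - x) \<le> M * s * (2 * B)"
      using M[OF x0] l2B[of x y] x y \<open>0 < s\<close> \<open>0 < M\<close> by (intro mult_mono) auto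
    also have "\<dots> < m"
      using s(3) \<open>0 < M\<close> \<open>0 < B\<close> by (simp add: \<delta>_def field_simps)
    also have "\<dots> \<le> norm (g x)" using q(2)[OF x0] by (simp add: m_def)
    finally show "0 < leg_variation (g x) (H x) x y \<xi>"
      using leg_variation_pos[OF _ y(2) s(1,2) _ \<xi>] D(5)[of x] x0 r0 by blast
  next
    fix x y s c and v :: 'a
    assume x: "x \<in> S \<inter> ball p r" and y: "y \<in> S" "y \<noteq> x"
      and s: "s = unit_direction x y \<bullet> sgn (g x)" "0 < s" "s < \<delta>"
      and v: "v = unit_direction x y - s *\<^sub>R sgn (g x)" "c *\<^sub>R v \<noteq> 0"
    have x0: "x \<in> cball p r0" using x r by (auto simp: subset_iff)
    then have g0: "g x \<noteq> 0" using D(5) r0 by blast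
    define e w l where "e = unit_direction x y" and "w = sgn v" and "l = norm (y - x)"
    have "0 < l" using y by (simp add: l_def)
    have n: "norm e = 1" "norm (sgn (g x)) = 1"
      using y g0 by (simp_all add: e_def norm_unit_direction norm_sgn)
    have ve: "v = e - (e \<bullet> sgn (g x)) *\<^sub>R sgn (g x)" using v s by (simp add: e_def)
    have "norm w = 1" using v(2) by (simp add: w_def norm_sgn)
    moreover have "w \<bullet> g x = 0"
      using norm_tangential_part(1)[OF n ve] g0 by (simp add: w_def sgn_div_norm)
    ultimately have \<kappa>w: "\<kappa> \<le> - (w \<bullet> H x w)" using \<kappa> x x0 by blast
    have eg: "e \<bullet> g x = s * norm (g x)" using g0 by (simp add: s e_def sgn_div_norm)
    have "s * norm (g x) / l < - (w \<bullet> H x w)"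
    proof (cases "l < r")
      case False
      have "s * norm (g x) / l \<le> s * G / r"
        using False r G[OF x0] s(2) \<open>0 < G\<close> by (intro frac_le mult_left_mono mult_nonneg_nonneg) auto
      also have "\<dots> < \<kappa>"
        using s(3) r \<open>0 < G\<close> by (simp add: \<delta>_def field_simps)
      finally show ?thesis using \<kappa>w by simp
    next
      case True
      have "y \<in> ball p (2 * r)"
        using True x dist_triangle[of p y x] by (simp add: l_def dist_norm norm_minus_commute)
      moreover have "x \<in> ball p (2 * r)" using x r by auto
      moreover have "ball p (2 * r) \<subseteq> U" using r(2) r0(2) by blast
      ultimately obtain z where z: "z \<in> ball p (2 * r)"
        and zz: "(y - x) \<bullet> g x = - ((y - x) \<bullet> H z (y - x)) / 2"
        using chord_taylor[OF chart, of p "2 * r" x y] x y by blast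
      have yx: "y - x = l *\<^sub>R e" using \<open>0 < l\<close> by (simp add: e_def l_def unit_direction_def)
      have "l * (s * norm (g x)) = l * (- (l * (e \<bullet> H z e)) / 2)"
        using zz unfolding yx by (simp add: blinfun.scaleR_right eg)
      then have "s * norm (g x) = - (l * (e \<bullet> H z e)) / 2"
        using \<open>0 < l\<close> by (metis less_irrefl mult_left_cancel)
      then have "s * norm (g x) / l = - (e \<bullet> H z e) / 2"
        using \<open>0 < l\<close> by (simp add: field_simps)
      moreover have "- (e \<bullet> H z e) \<le> - (w \<bullet> H x w) + \<kappa> / 2"
      proof -
        have "norm (e - w) \<le> 2 * s"
          using sgn_tangential_part_close[OF n ve] v(2) s by (auto simp: e_def w_def)
        then have "norm (H x) * norm (e - w) \<le> M * (2 * s)"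
          using M[OF x0] \<open>0 < M\<close> by (intro mult_mono) auto
        also have "\<dots> \<le> \<kappa> / 8"
          using s(3) \<open>0 < M\<close> by (simp add: \<delta>_def field_simps)
        finally have "2 * norm (H x) * norm (e - w) \<le> \<kappa> / 4" by simp
        moreover have "norm (H z - H x) \<le> \<kappa> / 4"
          using Hvar[of x z] x z r by auto
        ultimately show ?thesis
          using quadratic_form_diff[OF n(1) \<open>norm w = 1\<close>, of "H z" "H x"] by linarith
      qed
      ultimately show ?thesis using \<kappa>w \<open>0 < \<kappa>\<close> by linarith
    qed
    then show "leg_variation (g x) (H x) x y (c *\<^sub>R v) < 0"
      unfolding w_def l_def by (intro leg_variation_neg[OF g0 y(2) s(1,2) v(1) _ v(2)])
  qed
qed

section \<open>Billiard trajectories with small reflection angle\<close>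

lemma v0_level_chart:
  assumes "level_chart S U f g H" and "x \<in> S" "x \<in> U"
  shows "v0 S x y = unit_direction x y - (unit_direction x y \<bullet> sgn (g x)) *\<^sub>R sgn (g x)"
  unfolding v0_def tangent_projection_level_chart[OF assms]
  by (simp add: sgn_div_norm power2_norm_eq_inner[symmetric] power2_eq_square divide_inverse mult_ac)

text \<open>The left-hand side is, up to sign, the sine of the reflection angle, and \<open>sin \<phi> \<le> \<phi>\<close>.\<close>

lemma sin_reflection_angle_less:
  assumes chart: "level_chart S U f g H" and x: "x \<in> S" "x \<in> U" and "y \<noteq> x"
    and "reflection_angle S x y < \<delta>"
  shows "unit_direction x y \<bullet> sgn (g x) < \<delta>"
proof -
  define s where "s = unit_direction x y \<bullet> sgn (g x)"
  have n: "norm (unit_direction x y) = 1" "norm (sgn (g x)) = 1"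
    using \<open>y \<noteq> x\<close> level_chartD(5)[OF chart x(2)] by (auto simp: norm_unit_direction norm_sgn)
  have "\<bar>s\<bar> \<le> 1" using Cauchy_Schwarz_ineq2[of "unit_direction x y" "sgn (g x)"] n by (simp add: s_def)
  have "(norm (v0 S x y))\<^sup>2 = 1 - s\<^sup>2"
    using norm_tangential_part(3)[OF n v0_level_chart[OF chart x]] by (simp add: s_def)
  then have *: "reflection_angle S x y = arcsin \<bar>s\<bar>"
    by (simp add: reflection_angle_def)
  have "0 \<le> arcsin \<bar>s\<bar>" using \<open>\<bar>s\<bar> \<le> 1\<close> by (simp add: arcsin_nonneg)
  then have "sin (arcsin \<bar>s\<bar>) \<le> arcsin \<bar>s\<bar>" by (rule sin_x_le_x)
  then show ?thesis using * assms(5) \<open>\<bar>s\<bar> \<le> 1\<close> by (simp add: s_def)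
qed

text \<open>By the reflection law the two legs have the same normal component \<open>s\<close> and opposite tangential
  parts \<open>v\<close> and \<open>- v\<close>, so the bounds for a single leg apply to both with the same angle. That \<open>s\<close> is
  positive follows from strict convexity: the midpoint of the chord is an interior point.\<close>

lemma second_variation_signs_near:
  fixes K :: "'a::euclidean_space set"
  assumes "compact K" "convex K" and z: "z \<in> interior K"
    and C2: "C2_hypersurface (frontier K)" and "strictly_convex K" and "positive_curvature K"
    and p: "p \<in> frontier K"
  shows "\<exists>r>0. \<exists>\<delta>>0. \<forall>xm x0 x1. x0 \<in> ball p r \<and> billiard_piece K xm x0 x1 \<and>
           reflection_angle (frontier K) x0 x1 < \<delta> \<longrightarrow>
             (\<forall>\<xi>\<in>tangent_space (frontier K) x0. \<xi> \<noteq> 0 \<and> orthogonal \<xi> (v0 (frontier K) x0 x1) \<longrightarrow>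
                0 < second_variation (frontier K) (\<Phi>00 xm x1) x0 \<xi>) \<and>
             (\<forall>\<xi>\<in>tangent_space (frontier K) x0. \<xi> \<noteq> 0 \<and> (\<exists>c. \<xi> = c *\<^sub>R v0 (frontier K) x0 x1) \<longrightarrow>
                second_variation (frontier K) (\<Phi>00 xm x1) x0 \<xi> < 0)"
proof -
  define S where "S = frontier K"
  have "compact S" using \<open>compact K\<close> by (simp add: S_def compact_frontier)
  have SK: "S \<subseteq> K" using \<open>compact K\<close> by (simp add: S_def frontier_subset_compact)
  obtain U f g H where chart: "level_chart S U f g H" and "p \<in> U"
    and zg: "\<And>x. x \<in> U \<Longrightarrow> 0 < (z - x) \<bullet> g x"
    using inward_level_chart[OF assms(2) z C2 p] unfolding S_def by metis
  have neg: "\<xi> \<bullet> H x \<xi> < 0" if "x \<in> S \<inter> U" "\<xi> \<noteq> 0" "\<xi> \<bullet> g x = 0" for x \<xi>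
  proof -
    have x: "x \<in> frontier K" "x \<in> U" using that by (auto simp: S_def)
    have "0 < second_fundamental_form K x \<xi>"
      using \<open>positive_curvature K\<close> that x tangent_space_level_chart[OF chart]
      by (auto simp: positive_curvature_def S_def)
    then show ?thesis
      unfolding second_fundamental_form_level_chart[OF assms(2) z chart[unfolded S_def] x zg[OF x(2)] that(3)]
      using level_chartD(5)[OF chart x(2)] by (simp add: divide_less_0_iff)
  qed
  obtain r1 \<delta> where "0 < r1" "0 < \<delta>"
    and pos_leg: "\<And>x y s \<xi>. x \<in> S \<inter> ball p r1 \<Longrightarrow> y \<in> S \<Longrightarrow> y \<noteq> x \<Longrightarrow>
       s = unit_direction x y \<bullet> sgn (g x) \<Longrightarrow> 0 < s \<Longrightarrow> s < \<delta> \<Longrightarrow> \<xi> \<noteq> 0 \<Longrightarrow>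
       \<xi> \<bullet> unit_direction x y = 0 \<Longrightarrow> 0 < leg_variation (g x) (H x) x y \<xi>"
    and neg_leg: "\<And>x y s v c. x \<in> S \<inter> ball p r1 \<Longrightarrow> y \<in> S \<Longrightarrow> y \<noteq> x \<Longrightarrow>
       s = unit_direction x y \<bullet> sgn (g x) \<Longrightarrow> 0 < s \<Longrightarrow> s < \<delta> \<Longrightarrow>
       v = unit_direction x y - s *\<^sub>R sgn (g x) \<Longrightarrow> c *\<^sub>R v \<noteq> 0 \<Longrightarrow>
       leg_variation (g x) (H x) x y (c *\<^sub>R v) < 0"
  proof (rule leg_variation_signs_near[OF chart \<open>compact S\<close> \<open>p \<in> U\<close> neg], goal_cases)
    \<comment> \<open>The first three goals are the premises of \<open>neg\<close>; they hold by assumption.\<close>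
    case (4 r \<delta>)
    show ?case by (rule 4(1)[of r \<delta>]) (fact 4)+
  qed
  obtain r2 where "0 < r2" "ball p r2 \<subseteq> U"
    using level_chartD(1)[OF chart] \<open>p \<in> U\<close> openE by blast
  define r where "r = min r1 r2"
  have "0 < r" "ball p r \<subseteq> U" "ball p r \<subseteq> ball p r1"
    using \<open>0 < r1\<close> \<open>0 < r2\<close> \<open>ball p r2 \<subseteq> U\<close> by (auto simp: r_def)
  show ?thesis
    unfolding S_def[symmetric]
  proof (rule exI[of _ r], rule conjI[OF \<open>0 < r\<close>], rule exI[of _ \<delta>], rule conjI[OF \<open>0 < \<delta>\<close>],
      intro allI impI, elim conjE)
    fix xm x0 x1
    assume "x0 \<in> ball p r" and bp: "billiard_piece K xm x0 x1"
      and angle: "reflection_angle S x0 x1 < \<delta>"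
    then have x0: "x0 \<in> S" "x0 \<in> U" "x0 \<in> S \<inter> ball p r1"
      and xm: "xm \<in> S" "xm \<noteq> x0" and x1: "x1 \<in> S" "x1 \<noteq> x0"
      using \<open>ball p r \<subseteq> U\<close> \<open>ball p r \<subseteq> ball p r1\<close> by (auto simp: billiard_piece_def S_def)
    define n where "n = sgn (g x0)"
    have "norm n = 1" using level_chartD(5)[OF chart x0(2)] by (simp add: n_def norm_sgn)
    then have nn: "n \<bullet> n = 1" by (simp add: norm_eq_1)
    have inn: "inward_normal K x0 = n"
      and int: "\<And>y. y \<in> interior K \<Longrightarrow> 0 < (y - x0) \<bullet> g x0"
      using inward_normal_level_chart[OF assms(2) z chart[unfolded S_def] _ x0(2) zg[OF x0(2)]] x0(1)
      by (auto simp: S_def n_def)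
    define e s v where "e = unit_direction x0 x1" and "s = e \<bullet> n" and "v = e - s *\<^sub>R n"
    have v0: "v0 S x0 x1 = v"
      using v0_level_chart[OF chart x0(1,2)] by (simp add: v_def e_def s_def n_def)
    have em: "unit_direction x0 xm = - e + (2 * s) *\<^sub>R n"
    proof -
      define q where "q = unit_direction xm x0"
      have e: "e = q - (2 * (q \<bullet> n)) *\<^sub>R n" using bp by (simp add: billiard_piece_def e_def q_def inn)
      moreover from e have "s = - (q \<bullet> n)" by (simp add: s_def inner_diff_left nn)
      moreover have "unit_direction x0 xm = - q"
        by (simp add: q_def unit_direction_def norm_minus_commute algebra_simps)
      ultimately show ?thesis by (simp add: algebra_simps)
    qed
    then have sm: "s = unit_direction x0 xm \<bullet> n" by (simp add: s_def inner_diff_left nn)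
    have vm: "- v = unit_direction x0 xm - s *\<^sub>R n"
      unfolding em v_def scaleR_scaleR[symmetric] scaleR_2 by simp
    have "0 < s"
    proof -
      have "midpoint x0 x1 \<in> open_segment x0 x1" using x1 by simp
      moreover have "x0 \<in> K" "x1 \<in> K" using x0(1) x1(1) SK by auto
      then have "open_segment x0 x1 \<subseteq> interior K"
        using \<open>strictly_convex K\<close> x1(2) unfolding strictly_convex_def by simp
      ultimately have "midpoint x0 x1 \<in> interior K" by blast
      from int[OF this] have "0 < (midpoint x0 x1 - x0) \<bullet> g x0" .
      moreover have "midpoint x0 x1 - x0 = (1 / 2) *\<^sub>R (x1 - x0)"
        by (simp add: midpoint_def algebra_simps flip: scaleR_add_left)
      ultimately have "0 < (x1 - x0) \<bullet> g x0" by simp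
      then show ?thesis
        using x1 level_chartD(5)[OF chart x0(2)]
        by (simp add: s_def e_def n_def unit_direction_def sgn_div_norm zero_less_mult_iff)
    qed
    have "s < \<delta>"
      using sin_reflection_angle_less[OF chart x0(1,2) x1(2) angle] by (simp add: s_def e_def n_def)
    note s1 = s_def[unfolded e_def n_def] and sm' = sm[unfolded n_def]
    show "(\<forall>\<xi>\<in>tangent_space S x0. \<xi> \<noteq> 0 \<and> orthogonal \<xi> (v0 S x0 x1) \<longrightarrow>
          0 < second_variation S (\<Phi>00 xm x1) x0 \<xi>) \<and>
        (\<forall>\<xi>\<in>tangent_space S x0. \<xi> \<noteq> 0 \<and> (\<exists>c. \<xi> = c *\<^sub>R v0 S x0 x1) \<longrightarrow>
          second_variation S (\<Phi>00 xm x1) x0 \<xi> < 0)"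
      unfolding tangent_space_level_chart[OF chart x0(1,2)] v0
    proof (intro conjI ballI impI; elim conjE exE)
      fix \<xi> assume \<xi>: "\<xi> \<in> {\<xi>. \<xi> \<bullet> g x0 = 0}" "\<xi> \<noteq> 0" "orthogonal \<xi> v"
      have "\<xi> \<bullet> n = 0" using \<xi>(1) by (simp add: n_def sgn_div_norm)
      then have "\<xi> \<bullet> e = 0" "\<xi> \<bullet> unit_direction x0 xm = 0"
        using \<xi>(3) by (simp_all add: orthogonal_def v_def em inner_diff_right)
      then show "0 < second_variation S (\<Phi>00 xm x1) x0 \<xi>"
        using second_variation_length[OF chart x0(1,2) _ xm(2) x1(2)] \<xi>
          pos_leg[OF x0(3) x1 s1 \<open>0 < s\<close> \<open>s < \<delta>\<close> \<xi>(2)]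
          pos_leg[OF x0(3) xm sm' \<open>0 < s\<close> \<open>s < \<delta>\<close> \<xi>(2)]
        by (simp add: e_def)
    next
      fix \<xi> c assume \<xi>: "\<xi> \<in> {\<xi>. \<xi> \<bullet> g x0 = 0}" "\<xi> \<noteq> 0" "\<xi> = c *\<^sub>R v"
      have "leg_variation (g x0) (H x0) x0 x1 (c *\<^sub>R v) < 0"
        using neg_leg[OF x0(3) x1 s1 \<open>0 < s\<close> \<open>s < \<delta>\<close>, of v c] \<xi> by (simp add: v_def e_def n_def)
      moreover have "leg_variation (g x0) (H x0) x0 xm ((- c) *\<^sub>R (- v)) < 0"
        using neg_leg[OF x0(3) xm sm' \<open>0 < s\<close> \<open>s < \<delta>\<close>, of "- v" "- c", OF vm[unfolded n_def]] \<xi>(2,3) by simp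
      ultimately show "second_variation S (\<Phi>00 xm x1) x0 \<xi> < 0"
        using second_variation_length[OF chart x0(1,2) _ xm(2) x1(2)] \<xi> by simp
    qed
  qed
qed

theorem theorem3p1:
  fixes K \<Sigma> :: "'a::euclidean_space set"
  assumes "compact K" and "convex K" and "interior K \<noteq> {}"
    and "\<Sigma> = frontier K"
    and "C2_hypersurface \<Sigma>"
    and "strictly_convex K"
    and "positive_curvature K"
  shows "\<exists>C>0. \<forall>xm x0 x1.
           billiard_piece K xm x0 x1 \<and> reflection_angle \<Sigma> x0 x1 < C \<longrightarrow>
             (\<forall>\<xi>\<in>tangent_space \<Sigma> x0. \<xi> \<noteq> 0 \<and> orthogonal \<xi> (v0 \<Sigma> x0 x1) \<longrightarrow>
                0 < second_variation \<Sigma> (\<Phi>00 xm x1) x0 \<xi>) \<and>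
             (\<forall>\<xi>\<in>tangent_space \<Sigma> x0. \<xi> \<noteq> 0 \<and> (\<exists>c. \<xi> = c *\<^sub>R v0 \<Sigma> x0 x1) \<longrightarrow>
                second_variation \<Sigma> (\<Phi>00 xm x1) x0 \<xi> < 0)"
  (is "\<exists>C>0. \<forall>xm x0 x1. billiard_piece K xm x0 x1 \<and> ?angle x0 x1 < C \<longrightarrow> ?signs xm x0 x1")
proof -
  obtain z where z: "z \<in> interior K" using assms(3) by blast
  have "compact \<Sigma>" using assms(1,4) by (simp add: compact_frontier)
  define good where "good p r \<delta> \<longleftrightarrow> (\<forall>xm x0 x1. x0 \<in> ball p r \<and> billiard_piece K xm x0 x1 \<and>
      ?angle x0 x1 < \<delta> \<longrightarrow> ?signs xm x0 x1)" for p r \<delta>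
  have "\<forall>p\<in>\<Sigma>. \<exists>r \<delta>. 0 < r \<and> 0 < \<delta> \<and> good p r \<delta>"
    using second_variation_signs_near[OF assms(1,2) z assms(5)[unfolded assms(4)] assms(6,7)]
    unfolding good_def assms(4) by blast
  then obtain r \<delta> where r: "\<And>p. p \<in> \<Sigma> \<Longrightarrow> 0 < r p" and \<delta>: "\<And>p. p \<in> \<Sigma> \<Longrightarrow> 0 < \<delta> p"
    and loc: "\<And>p. p \<in> \<Sigma> \<Longrightarrow> good p (r p) (\<delta> p)"
    by metis
  have "\<Sigma> \<subseteq> (\<Union>p\<in>\<Sigma>. ball p (r p))" using r by fastforce
  then obtain T where T: "T \<subseteq> \<Sigma>" "finite T" "\<Sigma> \<subseteq> (\<Union>p\<in>T. ball p (r p))"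
    using compactE_image[OF \<open>compact \<Sigma>\<close>, of \<Sigma> "\<lambda>p. ball p (r p)"] by blast
  define C where "C = Min (insert 1 (\<delta> ` T))"
  have "0 < C" using T \<delta> by (auto simp: C_def)
  moreover have "?signs xm x0 x1" if "billiard_piece K xm x0 x1" "?angle x0 x1 < C" for xm x0 x1
  proof -
    have "x0 \<in> \<Sigma>" using that(1) assms(4) by (simp add: billiard_piece_def)
    then obtain p where p: "p \<in> T" "x0 \<in> ball p (r p)" using T(3) by blast
    have "C \<le> \<delta> p" using T(2) p(1) by (simp add: C_def)
    then have "?angle x0 x1 < \<delta> p" using that(2) by simp
    moreover have "good p (r p) (\<delta> p)" using loc p(1) T(1) by blast
    ultimately show ?thesis using p(2) that(1) unfolding good_def by blast
  qed
  ultimately show ?thesis by blast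
qed

end
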